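(* Consider the iterates $(\bm{\theta}^{U_s})_{s\ge 0}$ of accumulated decoupled learning (ADL) with $K\ge 1$ modules, $M\ge 1$ gradient accumulation steps and learning rates $\gamma_s>0$, that is, for every module $k\in\{1,\dots,K\}$ and every $s\ge 0$, $$\bm{\theta}_{q(k)}^{U_{s+1}}=\bm{\theta}_{q(k)}^{U_s}-\gamma_s\frac1M\sum_{j=0}^{M-1}\bm{g}_{\bm{\theta}_{q(k)}}^{U_s+j-2(K-k)},\qquad U_s=Ms .$$ Suppose that Assumption A (Lipschitz gradients with constant $L$) and Assumption B (bounded stochastic gradients with constant $A$), both given in the context, hold, that $\gamma_s$ is non-increasing in $s$, and that $L\gamma_s\le 1$ for all $s$. Let $\bm{\theta}^*$ be a global minimizer of $f$ and $\mathbb{T}_S=\sum_{s=0}^{S-1}\gamma_s$. If $\gamma_s$ further satisfies $\lim_{S\to\infty}\mathbb{T}_S=\infty$ and $\lim_{S\to\infty}\sum_{s=0}^{S-1}\gamma_s^2<\infty$, then the right-hand side of the bound $$\frac{1}{\mathbb{T}_S}\sum_{s=0}^{S-1}\gamma_s\,\mathbb{E}\{\|\bm{\bar g}_{\bm{\theta}}^{U_s}\|_2^2\}\le\frac{2\,(f(\bm{\theta}^0)-f(\bm{\theta}^* ))}{\mathbb{T}_S}+\frac{2AL\big(1+\frac1M\sum_{k=1}^{K}\bar d_k\big)\sum_{s=0}^{S-1}\gamma_s^2}{M\,\mathbb{T}_S}$$ converges to $0$ as $S\to\infty$, where $\bar d_k$ is the averaged level of staleness of module $k$.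
   Context: Setting. $f:\mathbb{R}^n\to\mathbb{R}$ is the (not necessarily convex) loss over the whole dataset $\bm{x}$ as a function of the parameter vector $\bm{\theta}$ of a network with $\mathcal{L}$ layers; $\bm{\theta}$ is the concatenation of layer blocks $\bm{\theta}_1,\dots,\bm{\theta}_{\mathcal{L}}$. The layer indices $\{1,\dots,\mathcal{L}\}$ are partitioned into $K$ consecutive groups $q(1),\dots,q(K)$ (modules), and $\bm{\theta}_{q(k)}$ is the concatenation of the blocks $\bm{\theta}_l$, $l\in q(k)$. For each mini-batch $\bm{x}_t$ (batch index $t$), $f_{\bm{x}_t}$ is the loss on that mini-batch. Indices. $M$ is the number of gradient accumulation steps, $s$ is the update index, and $U_s=Ms$. Parameters are constant between updates: for a batch index $t$, $\bm{\theta}^t=\bm{\theta}^{U_{\lfloor t/M\rfloor}}$. By convention $\bm{\theta}^{U_\alpha}=\bm{\theta}^0$ for $\alpha<0$, where $\bm{\theta}^0=\bm{\theta}^{U_0}$ is the (deterministic) initial parameter vector. Gradients. $\bm{\bar g}_{\bm{\theta}}^{t}=\nabla f(\bm{\theta}^t)$ is the full gradient and $\bm{g}_{\bm{\theta}}^t=\nabla f_{\bm{x}_t}(\bm{\theta}^t)$ is the stochastic gradient. Subscripts $\bm{\theta}_l$ or $\bm{\theta}_{q(k)}$ denote the corresponding blocks, e.g. $\bm{g}_{\bm{\theta}_{l}}^{t}=\partial f_{\bm{x}_t}(\bm{\theta}^t)/\partial\bm{\theta}_l$. Staleness. The level of staleness of module $k$ at accumulation step $j\in\{0,\dots,M-1\}$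 is $d_{k,j}=s-\lfloor (U_s+j-2(K-k))/M\rfloor$ (this does not depend on $s$), so that $\bm{g}_{\bm{\theta}_{q(k)}}^{U_s+j-2(K-k)}$ is the $q(k)$-block of $\nabla f_{\bm{x}_{U_s+j-2(K-k)}}(\bm{\theta}^{U_{s-d_{k,j}}})$. The averaged level of staleness is $\bar d_k=\frac1M\sum_{j=0}^{M-1}d_{k,j}$. Randomness. Mini-batches are drawn at random (uniformly) from the dataset. $\mathbb{E}_{\bm{x}}$ is the expectation over the draw of the mini-batches entering the update, the iterates $\bm{\theta}^{U_0},\dots,\bm{\theta}^{U_s}$ being treated as given. Stochastic gradients are unbiased: $\mathbb{E}_{\bm{x}}\{\bm{g}_{\bm{\theta}_l}^{t}\}=\bm{\bar g}_{\bm{\theta}_l}^{t}$ for every layer $l$ and every batch index $t$ used in the update. $\mathbb{E}$ is the full expectation over all randomness. Assumption A (Lipschitz continuity of gradients). $f$ is differentiable with Lipschitz continuous gradient with constant $L>0$, and for all update indices $\alpha,\beta$, all layers $l$ and all modules $k$: $\|\bm{\bar g}_{\bm{\theta}_l}^{U_\alpha}-\bm{\bar g}_{\bm{\theta}_l}^{U_\beta}\|_2\le L\|\bm{\theta}_l^{U_\alpha}-\bm{\theta}_l^{U_\beta}\|_2$, $\|\bm{\bar g}_{\bm{\theta}_{q(k)}}^{U_\alpha}-\bm{\bar g}_{\bm{\theta}_{q(k)}}^{U_\beta}\|_2\le L\|\bm{\theta}_{q(k)}^{U_\alpha}-\bm{\theta}_{q(k)}^{U_\beta}\|_2$ and $\|\bm{\bar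 g}_{\bm{\theta}}^{U_\alpha}-\bm{\bar g}_{\bm{\theta}}^{U_\beta}\|_2\le L\|\bm{\theta}^{U_\alpha}-\bm{\theta}^{U_\beta}\|_2$. Assumption B (bounded stochastic gradients). There is a constant $A>0$ such that for every batch index $t$, every layer $l$ and every module $k$: $\|\bm{g}_{\bm{\theta}_l}^{t}\|_2^2\le A$, $\|\bm{g}_{\bm{\theta}_{q(k)}}^{t}\|_2^2\le A$ and $\|\bm{g}_{\bm{\theta}}^{t}\|_2^2\le A$. *)

theory Defs
  imports "HOL-Probability.Probability"
begin

definition gradient :: "('a::euclidean_space \<Rightarrow> real) \<Rightarrow> 'a \<Rightarrow> 'a" where
  "gradient f x = (THE D. GDERIV f x :> D)"

lemma gradient_eqI:
  assumes "GDERIV f x :> D"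
  shows "gradient f x = D"
  unfolding gradient_def
proof (rule the_equality[where P = "\<lambda>D. GDERIV f x :> D", OF assms])
  fix D' assume "GDERIV f x :> D'"
  then have "(\<lambda>h. h \<bullet> D') = (\<lambda>h. h \<bullet> D)"
    using assms unfolding gderiv_def by (rule has_derivative_unique)
  then show "D' = D"
    by (metis vector_eq_ldot)
qed

lemma gderiv_gradient:
  assumes "f differentiable at x"
  shows "GDERIV f x :> gradient f x"
proof -
  obtain f' where f': "(f has_derivative f') (at x)"
    using assms unfolding differentiable_def by blast
  interpret linear f'
    using f' by (rule has_derivative_linear)
  define D where "D = (\<Sum>b\<in>Basis. f' b *\<^sub>R b)"
  have "f' h = h \<bullet> D" for h
  proof -
    have "f' h = f' (\<Sum>b\<in>Basis. (h \<bullet> b) *\<^sub>R b)"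
      by (simp add: euclidean_representation)
    also have "\<dots> = h \<bullet> D"
      by (simp add: D_def sum scale inner_sum_right mult.commute)
    finally show ?thesis .
  qed
  then have "GDERIV f x :> D"
    using f' unfolding gderiv_def by presburger
  then show ?thesis
    using gradient_eqI by metis
qed

text \<open>
  The parameter space is \<open>real ^ 'n\<close>, and \<open>layer i\<close> is the layer that coordinate \<open>i\<close> belongs to.
  The subvector of \<open>v\<close> belonging to the layers in \<open>ls\<close> is represented by \<open>v\<close> with all the other
  coordinates set to zero. This preserves the Euclidean norm of the subvector and lets blocks of
  different dimensions live in one type.
\<close>

definition block :: "('n::finite \<Rightarrow> nat) \<Rightarrow> nat set \<Rightarrow> real ^ 'n \<Rightarrow> real ^ 'n" where
  "block layer ls v = (\<chi> i. if layer i \<in> ls then v $ i else 0)"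

definition consecutive_groups :: "nat \<Rightarrow> nat \<Rightarrow> (nat \<Rightarrow> nat set) \<Rightarrow> bool" where
  "consecutive_groups N K q \<longleftrightarrow>
     (\<exists>b. b 0 = 0 \<and> b K = N \<and> (\<forall>k<K. b k < b (Suc k) \<and> q (Suc k) = {b k<..b (Suc k)}))"

text \<open>
  Batch indices are integers: the first updates refer to batches with a negative index.
\<close>

definition batch_index :: "nat \<Rightarrow> nat \<Rightarrow> nat \<Rightarrow> nat \<Rightarrow> nat \<Rightarrow> int" where
  "batch_index M K s k j = int (M * s) + int j - 2 * (int K - int k)"

text \<open>
  The staleness is \<open>s - \<lfloor>(M s + j - 2 (K - k)) / M\<rfloor>\<close>, which is independent of \<open>s\<close>; the definition
  takes \<open>s = 0\<close>.
\<close>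

definition staleness :: "nat \<Rightarrow> nat \<Rightarrow> nat \<Rightarrow> nat \<Rightarrow> int" where
  "staleness M K k j = - (batch_index M K 0 k j div int M)"

lemma staleness_eq:
  assumes "M \<ge> 1"
  shows "staleness M K k j = int s - batch_index M K s k j div int M"
proof -
  have "batch_index M K s k j = batch_index M K 0 k j + int s * int M"
    by (simp add: batch_index_def)
  then show ?thesis
    using assms by (simp add: staleness_def)
qed

lemma staleness_eq_floor:
  assumes "M \<ge> 1"
  shows "staleness M K k j = int s - \<lfloor>real_of_int (batch_index M K s k j) / real M\<rfloor>"
  using staleness_eq[OF assms, of K k j s]
    floor_divide_of_int_eq[of "batch_index M K s k j" "int M", where ?'a = real]
  by simp

definition avg_staleness :: "nat \<Rightarrow> nat \<Rightarrow> nat \<Rightarrow> real" where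
  "avg_staleness M K k = (1 / real M) * (\<Sum>j<M. real_of_int (staleness M K k j))"

text \<open>
  \<open>\<theta> s \<omega>\<close> is the parameter vector after \<open>s\<close> updates. Parameters are constant between updates, and
  \<open>nat\<close> sends negative update indices to \<open>0\<close>, that is, to the initial parameter vector.
\<close>

definition params_at :: "nat \<Rightarrow> (nat \<Rightarrow> 'w \<Rightarrow> real ^ 'n::finite) \<Rightarrow> int \<Rightarrow> 'w \<Rightarrow> real ^ 'n" where
  "params_at M \<theta> t \<omega> = \<theta> (nat (t div int M)) \<omega>"

definition stoch_grad ::
  "nat \<Rightarrow> ('b \<Rightarrow> real ^ 'n::finite \<Rightarrow> real) \<Rightarrow> (int \<Rightarrow> 'w \<Rightarrow> 'b) \<Rightarrow> (nat \<Rightarrow> 'w \<Rightarrow> real ^ 'n)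
     \<Rightarrow> int \<Rightarrow> 'w \<Rightarrow> real ^ 'n" where
  "stoch_grad M fb X \<theta> t \<omega> = gradient (fb (X t \<omega>)) (params_at M \<theta> t \<omega>)"

text \<open>
  \<open>B\<close> is the finite collection of mini-batches that can be drawn from the dataset. No independence
  of the draws is required.
\<close>

definition uniform_batches :: "'w measure \<Rightarrow> 'b set \<Rightarrow> (int \<Rightarrow> 'w \<Rightarrow> 'b) \<Rightarrow> bool" where
  "uniform_batches P B X \<longleftrightarrow>
     finite B \<and> B \<noteq> {} \<and>
     (\<forall>t. X t \<in> measurable P (count_space B) \<and>
          distr P (count_space B) (X t) = uniform_count_measure B)"

definition adl_iterates ::
  "'w measure \<Rightarrow> ('n::finite \<Rightarrow> nat) \<Rightarrow> nat \<Rightarrow> (nat \<Rightarrow> nat set) \<Rightarrow> nat \<Rightarrow> (nat \<Rightarrow> real)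
     \<Rightarrow> ('b \<Rightarrow> real ^ 'n \<Rightarrow> real) \<Rightarrow> (int \<Rightarrow> 'w \<Rightarrow> 'b) \<Rightarrow> real ^ 'n \<Rightarrow> (nat \<Rightarrow> 'w \<Rightarrow> real ^ 'n)
     \<Rightarrow> bool" where
  "adl_iterates P layer K q M \<gamma> fb X \<theta>0 \<theta> \<longleftrightarrow>
     (\<forall>\<omega>\<in>space P. \<theta> 0 \<omega> = \<theta>0) \<and>
     (\<forall>\<omega>\<in>space P. \<forall>s. \<forall>k\<in>{1..K}.
        block layer (q k) (\<theta> (Suc s) \<omega>) =
          block layer (q k) (\<theta> s \<omega>) -
          (\<gamma> s * (1 / real M)) *\<^sub>R
            (\<Sum>j<M. block layer (q k) (stoch_grad M fb X \<theta> (batch_index M K s k j) \<omega>)))"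

text \<open>
  The expectation is over the draw \<open>\<eta>\<close> of the mini-batch, while the iterates are held fixed at the
  values they take for \<open>\<omega>\<close>. Conditioning on the iterates would be a different requirement: a
  mini-batch enters the updates of different modules at different times, so the iterates carry
  information about mini-batches that are still to be used.
\<close>

definition unbiased_gradients ::
  "'w measure \<Rightarrow> ('n::finite \<Rightarrow> nat) \<Rightarrow> nat \<Rightarrow> nat \<Rightarrow> nat \<Rightarrow> (real ^ 'n \<Rightarrow> real)
     \<Rightarrow> ('b \<Rightarrow> real ^ 'n \<Rightarrow> real) \<Rightarrow> (int \<Rightarrow> 'w \<Rightarrow> 'b) \<Rightarrow> (nat \<Rightarrow> 'w \<Rightarrow> real ^ 'n) \<Rightarrow> bool" where
  "unbiased_gradients P layer N K M f fb X \<theta> \<longleftrightarrow>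
     (\<forall>\<omega>\<in>space P. \<forall>s. \<forall>k\<in>{1..K}. \<forall>j<M. \<forall>l\<in>{1..N}.
        (let t = batch_index M K s k j in
          integral\<^sup>L P (\<lambda>\<eta>. block layer {l} (gradient (fb (X t \<eta>)) (params_at M \<theta> t \<omega>))) =
          block layer {l} (gradient f (params_at M \<theta> t \<omega>))))"

definition lipschitz_gradients ::
  "'w measure \<Rightarrow> ('n::finite \<Rightarrow> nat) \<Rightarrow> nat \<Rightarrow> nat \<Rightarrow> (nat \<Rightarrow> nat set) \<Rightarrow> (real ^ 'n \<Rightarrow> real)
     \<Rightarrow> (nat \<Rightarrow> 'w \<Rightarrow> real ^ 'n) \<Rightarrow> real \<Rightarrow> bool" where
  "lipschitz_gradients P layer N K q f \<theta> L \<longleftrightarrow>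
     L > 0 \<and>
     (\<forall>w. f differentiable at w) \<and>
     L-lipschitz_on UNIV (gradient f) \<and>
     (\<forall>\<omega>\<in>space P. \<forall>\<alpha> \<beta>.
        (\<forall>l\<in>{1..N}.
           norm (block layer {l} (gradient f (\<theta> \<alpha> \<omega>)) - block layer {l} (gradient f (\<theta> \<beta> \<omega>)))
             \<le> L * norm (block layer {l} (\<theta> \<alpha> \<omega>) - block layer {l} (\<theta> \<beta> \<omega>))) \<and>
        (\<forall>k\<in>{1..K}.
           norm (block layer (q k) (gradient f (\<theta> \<alpha> \<omega>)) - block layer (q k) (gradient f (\<theta> \<beta> \<omega>)))
             \<le> L * norm (block layer (q k) (\<theta> \<alpha> \<omega>) - block layer (q k) (\<theta> \<beta> \<omega>))) \<and>
        norm (gradient f (\<theta> \<alpha> \<omega>) - gradient f (\<theta> \<beta> \<omega>)) \<le> L * norm (\<theta> \<alpha> \<omega> - \<theta> \<beta> \<omega>))"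

definition bounded_stoch_grads ::
  "'w measure \<Rightarrow> ('n::finite \<Rightarrow> nat) \<Rightarrow> nat \<Rightarrow> nat \<Rightarrow> (nat \<Rightarrow> nat set) \<Rightarrow> nat
     \<Rightarrow> ('b \<Rightarrow> real ^ 'n \<Rightarrow> real) \<Rightarrow> (int \<Rightarrow> 'w \<Rightarrow> 'b) \<Rightarrow> (nat \<Rightarrow> 'w \<Rightarrow> real ^ 'n) \<Rightarrow> real
     \<Rightarrow> bool" where
  "bounded_stoch_grads P layer N K q M fb X \<theta> A \<longleftrightarrow>
     A > 0 \<and>
     (\<forall>\<omega>\<in>space P. \<forall>t.
        (\<forall>l\<in>{1..N}. (norm (block layer {l} (stoch_grad M fb X \<theta> t \<omega>)))\<^sup>2 \<le> A) \<and>
        (\<forall>k\<in>{1..K}. (norm (block layer (q k) (stoch_grad M fb X \<theta> t \<omega>)))\<^sup>2 \<le> A) \<and>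
        (norm (stoch_grad M fb X \<theta> t \<omega>))\<^sup>2 \<le> A)"

end

theory Submission
  imports Defs
begin

text \<open>Each summand is a convergent numerator over the total step size \<Sum>s<S. \<gamma> s,
  which diverges, so each tends to 0. The first numerator is constant. The second is a factor
  independent of S, in which the staleness is absorbed, times the partial sums of the convergent
  series of squared learning rates. The quotient rule \<open>tendsto_divide_0\<close> settles
  both.\<close>

theorem corollary1:
  fixes P :: "'w measure"
    and B :: "'b set"
    and X :: "int \<Rightarrow> 'w \<Rightarrow> 'b"
    and f :: "real ^ 'n::finite \<Rightarrow> real"
    and fb :: "'b \<Rightarrow> real ^ 'n \<Rightarrow> real"
    and layer :: "'n \<Rightarrow> nat"
    and N K M :: nat
    and q :: "nat \<Rightarrow> nat set"
    and \<gamma> :: "nat \<Rightarrow> real"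
    and \<theta> :: "nat \<Rightarrow> 'w \<Rightarrow> real ^ 'n"
    and \<theta>0 \<theta>star :: "real ^ 'n"
    and L A :: real
  assumes "prob_space P"
    and "uniform_batches P B X"
    and "\<And>i. layer i \<in> {1..N}"
    and "K \<ge> 1" and "M \<ge> 1"
    and "consecutive_groups N K q"
    and "\<And>b w. b \<in> B \<Longrightarrow> fb b differentiable at w"
    and "\<And>s. \<gamma> s > 0"
    and "adl_iterates P layer K q M \<gamma> fb X \<theta>0 \<theta>"
    and "unbiased_gradients P layer N K M f fb X \<theta>"
    and "lipschitz_gradients P layer N K q f \<theta> L"
    and "bounded_stoch_grads P layer N K q M fb X \<theta> A"
    and "decseq \<gamma>"
    and "\<And>s. L * \<gamma> s \<le> 1"
    and "\<And>w. f \<theta>star \<le> f w"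
    and "filterlim (\<lambda>S. \<Sum>s<S. \<gamma> s) at_top sequentially"
    and "summable (\<lambda>s. (\<gamma> s)\<^sup>2)"
  shows "(\<lambda>S. 2 * (f \<theta>0 - f \<theta>star) / (\<Sum>s<S. \<gamma> s)
            + 2 * A * L * (1 + (1 / real M) * (\<Sum>k=1..K. avg_staleness M K k)) * (\<Sum>s<S. (\<gamma> s)\<^sup>2)
              / (real M * (\<Sum>s<S. \<gamma> s))) \<longlonglongrightarrow> 0"
proof (intro tendsto_add_zero)
  \<comment> \<open>\<open>tendsto_divide_0\<close> wants a denominator that diverges in norm, which
    is weaker than divergence to \<open>at_top\<close>.\<close>
  have T: "filterlim (\<lambda>S. \<Sum>s<S. \<gamma> s) at_infinity sequentially"
    using assms(16) by (rule filterlim_at_top_imp_at_infinity)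
  then show "(\<lambda>S. 2 * (f \<theta>0 - f \<theta>star) / (\<Sum>s<S. \<gamma> s)) \<longlonglongrightarrow> 0"
    by (rule tendsto_divide_0[OF tendsto_const])
  define c where "c = 2 * A * L * (1 + (1 / real M) * (\<Sum>k=1..K. avg_staleness M K k))"
  \<comment> \<open>Moving \<open>real M\<close> out of the denominator leaves the same divisor as
    before, so \<open>T\<close> applies again; the numerator converges by
    \<open>summable_LIMSEQ\<close>. The remaining side condition \<open>real M \<noteq> 0\<close>
    comes from \<open>M \<ge> 1\<close>.\<close>
  have "(\<lambda>S. c * (\<Sum>s<S. (\<gamma> s)\<^sup>2) / real M / (\<Sum>s<S. \<gamma> s)) \<longlonglongrightarrow> 0"
    by (rule tendsto_divide_0[OF tendsto_divide[OF tendsto_mult[OF tendsto_const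
          summable_LIMSEQ[OF assms(17)]] tendsto_const] T]) (use assms(5) in simp)
  then show "(\<lambda>S. 2 * A * L * (1 + (1 / real M) * (\<Sum>k=1..K. avg_staleness M K k))
      * (\<Sum>s<S. (\<gamma> s)\<^sup>2) / (real M * (\<Sum>s<S. \<gamma> s))) \<longlonglongrightarrow> 0"
    unfolding c_def by (simp only: divide_divide_eq_left)
qed

end
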